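(* Let $\{V_n\}_{n\ge 0}$ be a generalized Tribonacci sequence with parameters $r,s,t$, let $\{O_{v,n}\}_{n\ge 0}$ be the associated generalized Tribonacci octonions, and let $\alpha,\omega_1,\omega_2$ be the roots of $x^3-rx^2-sx-t=0$. Put $\phi=(\alpha-\omega_1)(\alpha-\omega_2)(\omega_1-\omega_2)$. Then for every integer $n\ge 0$, $$Nr^{2}(O_{v,n})=\frac{1}{\phi^{2}}\Bigl((\omega_{1}-\omega_{2})^{2}P^{2}\,\overline{\alpha}\,\alpha^{2n}+(\alpha-\omega_{2})^{2}Q^{2}\,\overline{\omega_{1}}\,\omega_{1}^{2n}+(\alpha-\omega_{1})^{2}R^{2}\,\overline{\omega_{2}}\,\omega_{2}^{2n}-2K\Bigr),$$ where $$K=(\omega_{1}-\omega_{2})(\alpha-\omega_{2})PQ\,\underline{\alpha\omega_{1}}(\alpha\omega_{1})^{n}-(\omega_{1}-\omega_{2})(\alpha-\omega_{1})PR\,\underline{\alpha\omega_{2}}(\alpha\omega_{2})^{n}+(\alpha-\omega_{1})(\alpha-\omega_{2})QR\,\underline{\omega_{1}\omega_{2}}(\omega_{1}\omega_{2})^{n}.$$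
   Context: Generalized Tribonacci sequence: $r,s,t$ are real numbers, $V_0,V_1,V_2$ are arbitrary integers, and $V_n=rV_{n-1}+sV_{n-2}+tV_{n-3}$ for $n\ge 3$. Standing assumption: $\Delta=\frac{r^{3}t}{27}-\frac{r^{2}s^{2}}{108}+\frac{rst}{6}-\frac{s^{3}}{27}+\frac{t^{2}}{4}>0$, so that $x^3-rx^2-sx-t=0$ has one real root $\alpha$ and two nonreal complex conjugate roots $\omega_1,\omega_2$ (in particular the roots are distinct). Constants: $P=V_{2}-(\omega_{1}+\omega_{2})V_{1}+\omega_{1}\omega_{2}V_{0}$, $Q=V_{2}-(\alpha+\omega_{2})V_{1}+\alpha\omega_{2}V_{0}$, $R=V_{2}-(\alpha+\omega_{1})V_{1}+\alpha\omega_{1}V_{0}$. Notation (all are complex numbers; the overline here is NOT complex conjugation): $\overline{\alpha}=\sum_{l=0}^{7}\alpha^{2l}$, $\overline{\omega_1}=\sum_{l=0}^{7}\omega_1^{2l}$, $\overline{\omega_2}=\sum_{l=0}^{7}\omega_2^{2l}$, $\underline{\alpha\omega_1}=\sum_{l=0}^{7}(\alpha\omega_1)^l$, $\underline{\alpha\omega_2}=\sum_{l=0}^{7}(\alpha\omega_2)^l$, $\underline{\omega_1\omega_2}=\sum_{l=0}^{7}(\omega_1\omega_2)^l$. Octonions: $\mathbb{O}$ is the real octonion algebra, an $8$-dimensional real vector space with basis $e_0=\mathbf{1},e_1,\dots,e_7$. For $p=\sum_{l=0}^7 a_le_l$ the norm is $Nr(p)=\sqrt{\sum_{l=0}^7a_l^2}$,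 so $Nr^2(p)=\sum_{l=0}^{7}a_l^2$. The $n$-th generalized Tribonacci octonion is $O_{v,n}=\sum_{l=0}^{7}V_{n+l}e_l$, $n\ge 0$. *)

theory Defs
  imports Complex_Main
begin

text \<open>An octonion is given by its coordinates at \<open>e\<^sub>0, \<dots>, e\<^sub>7\<close>, extended by zero to all indices.\<close>

typedef octonion = "{a :: nat \<Rightarrow> real. \<forall>l>7. a l = 0}"
  morphisms coord Octonion
  by (rule exI[of _ "\<lambda>_. 0"]) simp

setup_lifting type_definition_octonion

instantiation octonion :: real_vector
begin

lift_definition zero_octonion :: octonion is "\<lambda>_. 0" by simp
lift_definition plus_octonion :: "octonion \<Rightarrow> octonion \<Rightarrow> octonion" is "\<lambda>a b l. a l + b l" by simp
lift_definition minus_octonion :: "octonion \<Rightarrow> octonion \<Rightarrow> octonion" is "\<lambda>a b l. a l - b l" by simp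
lift_definition uminus_octonion :: "octonion \<Rightarrow> octonion" is "\<lambda>a l. - a l" by simp
lift_definition scaleR_octonion :: "real \<Rightarrow> octonion \<Rightarrow> octonion" is "\<lambda>c a l. c * a l" by simp

instance
  by standard (transfer; force simp: algebra_simps)+

end

lift_definition oct_basis :: "nat \<Rightarrow> octonion" is "\<lambda>i l. if l = i \<and> i \<le> 7 then 1 else 0"
  by simp

text \<open>The lines of the Fano plane, oriented so that \<open>e\<^sub>i e\<^sub>j = e\<^sub>k\<close> for \<open>(i, j, k)\<close> in the list
  and for its cyclic permutations.\<close>

definition oct_lines :: "(nat \<times> nat \<times> nat) set" where
  "oct_lines = {(1,2,3), (1,4,5), (1,7,6), (2,4,6), (2,5,7), (3,4,7), (3,6,5)}"

definition oct_oriented :: "nat \<Rightarrow> nat \<Rightarrow> nat \<Rightarrow> bool" where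
  "oct_oriented i j k \<longleftrightarrow> (i,j,k) \<in> oct_lines \<or> (j,k,i) \<in> oct_lines \<or> (k,i,j) \<in> oct_lines"

text \<open>The coordinate of \<open>e\<^sub>i e\<^sub>j\<close> at \<open>e\<^sub>k\<close>.\<close>

definition oct_const :: "nat \<Rightarrow> nat \<Rightarrow> nat \<Rightarrow> real" where
  "oct_const i j k =
    (if i = 0 then (if k = j then 1 else 0)
     else if j = 0 then (if k = i then 1 else 0)
     else if i = j then (if k = 0 then -1 else 0)
     else if oct_oriented i j k then 1
     else if oct_oriented j i k then -1
     else 0)"

instantiation octonion :: "{one, times}"
begin

definition one_octonion :: octonion where "1 = oct_basis 0"

lift_definition times_octonion :: "octonion \<Rightarrow> octonion \<Rightarrow> octonion" is
  "\<lambda>a b k. if k \<le> 7 then \<Sum>i\<le>7. \<Sum>j\<le>7. oct_const i j k * a i * b j else 0"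
  by simp

instance ..

end

definition Nr :: "octonion \<Rightarrow> real" where
  "Nr p = sqrt (\<Sum>l\<le>7. (coord p l)\<^sup>2)"

lemma octonion_expand: "p = (\<Sum>l\<le>7. coord p l *\<^sub>R oct_basis l)"
proof -
  have 1: "coord (\<Sum>l\<in>A. f l) k = (\<Sum>l\<in>A. coord (f l) k)" for A :: "nat set" and f k
    by (induction A rule: infinite_finite_induct)
       (simp_all add: zero_octonion.rep_eq plus_octonion.rep_eq)
  have 2: "coord p k = 0" if "k > 7" for k
    using coord[of p] that by simp
  show ?thesis
    by (intro coord_inject[THEN iffD1] ext)
       (auto simp: 1 2 scaleR_octonion.rep_eq oct_basis.rep_eq if_distrib cong: if_cong)
qed

text \<open>Only the initial values are required to be integers; the later terms are real, as are the
  parameters.\<close>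

definition gen_tribonacci :: "real \<Rightarrow> real \<Rightarrow> real \<Rightarrow> (nat \<Rightarrow> real) \<Rightarrow> bool" where
  "gen_tribonacci r s t V \<longleftrightarrow>
     V 0 \<in> \<int> \<and> V 1 \<in> \<int> \<and> V 2 \<in> \<int> \<and>
     (\<forall>n\<ge>3. V n = r * V (n - 1) + s * V (n - 2) + t * V (n - 3))"

definition tribonacci_octonion :: "(nat \<Rightarrow> real) \<Rightarrow> nat \<Rightarrow> octonion" where
  "tribonacci_octonion V n = (\<Sum>l\<le>7. V (n + l) *\<^sub>R oct_basis l)"

definition cubic_Delta :: "real \<Rightarrow> real \<Rightarrow> real \<Rightarrow> real" where
  "cubic_Delta r s t =
     r^3 * t / 27 - r^2 * s^2 / 108 + r * s * t / 6 - s^3 / 27 + t^2 / 4"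

text \<open>These render an overline and an underline; the overline is not complex conjugation, and it sums
  even powers while the underline sums all powers.\<close>

definition over_sum :: "complex \<Rightarrow> complex" where
  "over_sum x = (\<Sum>l\<le>7. x ^ (2 * l))"

definition under_sum :: "complex \<Rightarrow> complex" where
  "under_sum x = (\<Sum>l\<le>7. x ^ l)"

end

theory Submission
  imports Defs
begin

text \<open>Two facts carry the formula. The first is the Binet formula
  \<open>\<phi> V\<^sub>n = A \<alpha>\<^sup>n - B \<omega>\<^sub>1\<^sup>n + C \<omega>\<^sub>2\<^sup>n\<close> with \<open>A = (\<omega>\<^sub>1 - \<omega>\<^sub>2) P\<close>, \<open>B = (\<alpha> - \<omega>\<^sub>2) Q\<close> and
  \<open>C = (\<alpha> - \<omega>\<^sub>1) R\<close> (\<open>binet_tribonacci\<close>). It holds because each of the three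
  geometric sequences satisfies the recurrence and the coefficients are chosen to match the
  initial values. Squaring it for the index \<open>n + l\<close> gives
  three square terms and the cross terms \<open>- 2 (A B (\<alpha> \<omega>\<^sub>1)\<^sup>n\<^sup>+\<^sup>l - A C (\<alpha> \<omega>\<^sub>2)\<^sup>n\<^sup>+\<^sup>l + B C (\<omega>\<^sub>1 \<omega>\<^sub>2)\<^sup>n\<^sup>+\<^sup>l)\<close>.
  Summing over the eight coordinates \<open>l\<close> turns the squares into the overlined sums and the
  cross terms into the underlined ones, which together form \<open>- 2 K\<close>.

  The second fact is that \<open>\<alpha>\<close>, \<open>\<omega>\<^sub>1\<close>, \<open>\<omega>\<^sub>2\<close> are distinct and related to \<open>r\<close>, \<open>s\<close>, \<open>t\<close> by Vieta's
  formulas (\<open>vieta_of_root_set\<close>), which allows both the use of the Binet formula and the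
  division by \<open>\<phi>\<^sup>2\<close>. The set of roots alone says nothing about multiplicities. They are controlled
  by \<open>\<Delta>\<close>, because \<open>- 108 \<Delta>\<close> is the discriminant of the cubic: as \<open>\<Delta> \<noteq> 0\<close>, the cubic
  has no multiple root, so the three elements listed in the root set are its three simple
  roots.\<close>

lemma cubic_splits:
  fixes r s t a :: complex
  assumes root: "a^3 - r * a^2 - s * a - t = 0"
  obtains b c where "r = a + b + c" "s = - (a * b + a * c + b * c)" "t = a * b * c"
proof -
  \<comment> \<open>Dividing by \<open>x - a\<close> leaves \<open>x\<^sup>2 - p x + q\<close>; \<open>b\<close> and \<open>c\<close> come from the quadratic formula.\<close>
  define p q where "p = r - a" and "q = a^2 - r * a - s"
  define d where "d = csqrt (p^2 - 4 * q)"
  define b c where "b = (p + d) / 2" and "c = (p - d) / 2"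
  have sum: "b + c = p"
    by (simp add: b_def c_def field_simps)
  have "b * c = (p^2 - d^2) / 4"
    by (simp add: b_def c_def power2_eq_square algebra_simps)
  also have "\<dots> = q"
    by (simp add: d_def)
  finally have prod: "b * c = q" .
  have r: "r = a + b + c"
    using sum by (simp add: p_def algebra_simps)
  moreover have "s = - (a * b + a * c + b * c)"
    using prod by (simp add: q_def r power2_eq_square algebra_simps)
  moreover have "t = a * q"
    using root by (simp add: q_def power2_eq_square power3_eq_cube algebra_simps)
  then have "t = a * b * c"
    by (simp add: prod mult.assoc)
  ultimately show ?thesis
    by (rule that)
qed

lemma cubic_Delta_discriminant:
  fixes a b c :: complex
  assumes "of_real r = a + b + c" "of_real s = - (a * b + a * c + b * c)" "of_real t = a * b * c"
  shows "of_real (108 * cubic_Delta r s t) = - (((a - b) * (a - c) * (b - c))^2)"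
proof -
  have "108 * cubic_Delta r s t =
      4 * r^3 * t - r^2 * s^2 + 18 * r * s * t - 4 * s^3 + 27 * t^2"
    by (simp add: cubic_Delta_def field_simps)
  then have "complex_of_real (108 * cubic_Delta r s t) =
      4 * of_real r^3 * of_real t - of_real r^2 * of_real s^2
        + 18 * of_real r * of_real s * of_real t - 4 * of_real s^3 + 27 * of_real t^2"
    by simp
  then show ?thesis
    unfolding assms by algebra
qed

text \<open>A nonzero discriminant makes the linear factors \<open>x - a\<close>, \<open>x - b\<close>, \<open>x - c\<close> pairwise different.
  The root set then has three elements, so \<open>\<omega>1\<close> and \<open>\<omega>2\<close> are \<open>b\<close> and \<open>c\<close> in some order, and the
  elementary symmetric functions do not depend on the order.\<close>

lemma vieta_of_root_set:
  fixes \<alpha> \<omega>1 \<omega>2 :: complex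
  assumes Delta: "cubic_Delta r s t \<noteq> 0"
    and roots: "{x :: complex. x^3 - of_real r * x^2 - of_real s * x - of_real t = 0} = {\<alpha>, \<omega>1, \<omega>2}"
  shows "of_real r = \<alpha> + \<omega>1 + \<omega>2"
    and "of_real s = - (\<alpha> * \<omega>1 + \<alpha> * \<omega>2 + \<omega>1 * \<omega>2)"
    and "of_real t = \<alpha> * \<omega>1 * \<omega>2"
    and "(\<alpha> - \<omega>1) * (\<alpha> - \<omega>2) * (\<omega>1 - \<omega>2) \<noteq> 0"
proof -
  have "\<alpha>^3 - of_real r * \<alpha>^2 - of_real s * \<alpha> - of_real t = 0"
    using roots by blast
  then obtain b c where v: "of_real r = \<alpha> + b + c"
    "of_real s = - (\<alpha> * b + \<alpha> * c + b * c)" "of_real t = \<alpha> * b * c"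
    by (rule cubic_splits)
  have factors: "x^3 - of_real r * x^2 - of_real s * x - of_real t = (x - \<alpha>) * (x - b) * (x - c)"
    for x :: complex
    unfolding v by algebra
  have "{\<alpha>, \<omega>1, \<omega>2} = {\<alpha>, b, c}"
    unfolding roots[symmetric] factors by auto
  moreover have "\<alpha> \<noteq> b" "\<alpha> \<noteq> c" "b \<noteq> c"
    using cubic_Delta_discriminant[OF v] Delta by auto
  ultimately have "\<omega>1 = b \<and> \<omega>2 = c \<or> \<omega>1 = c \<and> \<omega>2 = b"
    unfolding set_eq_iff insert_iff empty_iff by metis
  then show "of_real r = \<alpha> + \<omega>1 + \<omega>2"
    and "of_real s = - (\<alpha> * \<omega>1 + \<alpha> * \<omega>2 + \<omega>1 * \<omega>2)"
    and "of_real t = \<alpha> * \<omega>1 * \<omega>2"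
    and "(\<alpha> - \<omega>1) * (\<alpha> - \<omega>2) * (\<omega>1 - \<omega>2) \<noteq> 0"
    using v \<open>\<alpha> \<noteq> b\<close> \<open>\<alpha> \<noteq> c\<close> \<open>b \<noteq> c\<close> by (auto simp: ac_simps)
qed

text \<open>The characteristic polynomial of the recurrence is \<open>(x - a) (x - b) (x - c)\<close>, so \<open>a\<^sup>n\<close>, \<open>b\<^sup>n\<close> and
  \<open>c\<^sup>n\<close> satisfy the recurrence, as does any linear combination of them. The coefficient of \<open>a\<^sup>n\<close>
  comes from the functional \<open>U\<^sub>2 - (b + c) U\<^sub>1 + b c U\<^sub>0\<close>, which vanishes on the sequences \<open>b\<^sup>n\<close> and
  \<open>c\<^sup>n\<close> and takes the value \<open>(a - b) (a - c)\<close> on \<open>a\<^sup>n\<close>; the other two arise in the same way. For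
  \<open>n < 3\<close> the claim is a polynomial identity. Keeping the denominator on the left makes the formula
  valid even when roots coincide.\<close>

lemma binet_tribonacci:
  fixes a b c :: "'a :: comm_ring_1" and U :: "nat \<Rightarrow> 'a"
  assumes rec: "\<And>n. U (n + 3) = (a + b + c) * U (n + 2) - (a * b + a * c + b * c) * U (n + 1)
      + a * b * c * U n"
  shows "(a - b) * (a - c) * (b - c) * U n =
    (b - c) * (U 2 - (b + c) * U 1 + b * c * U 0) * a ^ n
    - (a - c) * (U 2 - (a + c) * U 1 + a * c * U 0) * b ^ n
    + (a - b) * (U 2 - (a + b) * U 1 + a * b * U 0) * c ^ n"
    (is "?D * U n = ?A * a ^ n - ?B * b ^ n + ?C * c ^ n")
proof (induction n rule: less_induct)
  case (less n)
  consider "n = 0" | "n = 1" | "n = 2" | k where "n = k + 3"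
  proof -
    have "n = 0 \<or> n = 1 \<or> n = 2 \<or> n = (n - 3) + 3"
      by arith
    then show ?thesis
      using that by blast
  qed
  then show ?case
  proof cases
    case 4
    have "?D * U (k + 3) = (a + b + c) * (?D * U (k + 2))
        - (a * b + a * c + b * c) * (?D * U (k + 1)) + a * b * c * (?D * U k)"
      unfolding rec by (simp add: algebra_simps)
    also have "\<dots> = (a + b + c) * (?A * a ^ (k + 2) - ?B * b ^ (k + 2) + ?C * c ^ (k + 2))
        - (a * b + a * c + b * c) * (?A * a ^ (k + 1) - ?B * b ^ (k + 1) + ?C * c ^ (k + 1))
        + a * b * c * (?A * a ^ k - ?B * b ^ k + ?C * c ^ k)"
      using 4 by (simp only: less.IH)
    also have "\<dots> = ?A * a ^ (k + 3) - ?B * b ^ (k + 3) + ?C * c ^ (k + 3)"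
      \<comment> \<open>The coefficients are generalized so that only the powers are multiplied out.\<close>
    proof -
      have "(a + b + c) * (A * a ^ (k + 2) - B * b ^ (k + 2) + C * c ^ (k + 2))
        - (a * b + a * c + b * c) * (A * a ^ (k + 1) - B * b ^ (k + 1) + C * c ^ (k + 1))
        + a * b * c * (A * a ^ k - B * b ^ k + C * c ^ k)
        = A * a ^ (k + 3) - B * b ^ (k + 3) + C * c ^ (k + 3)" for A B C
        by (simp add: power_add power2_eq_square power3_eq_cube algebra_simps)
      then show ?thesis .
    qed
    finally show ?thesis
      unfolding 4 .
  qed (simp_all add: power2_eq_square algebra_simps)
qed

lemma Nr_tribonacci_octonion:
  "(Nr (tribonacci_octonion V n))\<^sup>2 = (\<Sum>l\<le>7. (V (n + l))\<^sup>2)"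
proof -
  have coord_sum: "coord (\<Sum>l\<in>A. f l) k = (\<Sum>l\<in>A. coord (f l) k)" for A :: "nat set" and f k
    by (induction A rule: infinite_finite_induct)
       (simp_all add: zero_octonion.rep_eq plus_octonion.rep_eq)
  have "coord (tribonacci_octonion V n) k = V (n + k)" if "k \<le> 7" for k
    using that by (simp add: tribonacci_octonion_def coord_sum scaleR_octonion.rep_eq
        oct_basis.rep_eq if_distrib cong: if_cong)
  then show ?thesis
    by (simp add: Nr_def sum_nonneg)
qed

theorem theorem3p4:
  fixes r s t :: real and V :: "nat \<Rightarrow> real" and \<alpha> \<omega>1 \<omega>2 P Q R \<phi> K :: complex
    and n :: nat
  assumes V: "gen_tribonacci r s t V"
    and Delta: "cubic_Delta r s t > 0"
    and roots: "{x :: complex. x^3 - of_real r * x^2 - of_real s * x - of_real t = 0} = {\<alpha>, \<omega>1, \<omega>2}"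
    and real_root: "\<alpha> \<in> \<real>"
    and P: "P = of_real (V 2) - (\<omega>1 + \<omega>2) * of_real (V 1) + \<omega>1 * \<omega>2 * of_real (V 0)"
    and Q: "Q = of_real (V 2) - (\<alpha> + \<omega>2) * of_real (V 1) + \<alpha> * \<omega>2 * of_real (V 0)"
    and R: "R = of_real (V 2) - (\<alpha> + \<omega>1) * of_real (V 1) + \<alpha> * \<omega>1 * of_real (V 0)"
    and \<phi>: "\<phi> = (\<alpha> - \<omega>1) * (\<alpha> - \<omega>2) * (\<omega>1 - \<omega>2)"
    and K: "K =
        (\<omega>1 - \<omega>2) * (\<alpha> - \<omega>2) * P * Q * under_sum (\<alpha> * \<omega>1) * (\<alpha> * \<omega>1) ^ n
      - (\<omega>1 - \<omega>2) * (\<alpha> - \<omega>1) * P * R * under_sum (\<alpha> * \<omega>2) * (\<alpha> * \<omega>2) ^ n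
      + (\<alpha> - \<omega>1) * (\<alpha> - \<omega>2) * Q * R * under_sum (\<omega>1 * \<omega>2) * (\<omega>1 * \<omega>2) ^ n"
  shows "of_real ((Nr (tribonacci_octonion V n))\<^sup>2) =
    1 / \<phi>^2 *
      ((\<omega>1 - \<omega>2)^2 * P^2 * over_sum \<alpha> * \<alpha> ^ (2 * n)
       + (\<alpha> - \<omega>2)^2 * Q^2 * over_sum \<omega>1 * \<omega>1 ^ (2 * n)
       + (\<alpha> - \<omega>1)^2 * R^2 * over_sum \<omega>2 * \<omega>2 ^ (2 * n)
       - 2 * K)"
proof -
  note vieta = vieta_of_root_set[OF less_imp_neq[OF Delta, symmetric] roots]
  have nz: "\<phi> \<noteq> 0"
    using vieta(4) by (simp add: \<phi>)
  define A B C where "A = (\<omega>1 - \<omega>2) * P" and "B = (\<alpha> - \<omega>2) * Q" and "C = (\<alpha> - \<omega>1) * R"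
  define U where "U m = complex_of_real (V m)" for m
  have "U (m + 3) = (\<alpha> + \<omega>1 + \<omega>2) * U (m + 2)
      - (\<alpha> * \<omega>1 + \<alpha> * \<omega>2 + \<omega>1 * \<omega>2) * U (m + 1) + \<alpha> * \<omega>1 * \<omega>2 * U m" for m
  proof -
    have "V (m + 3) = r * V (m + 2) + s * V (m + 1) + t * V m"
      using V by (simp add: gen_tribonacci_def)
    then have "U (m + 3) = of_real r * U (m + 2) + of_real s * U (m + 1) + of_real t * U m"
      by (simp add: U_def)
    then show ?thesis
      unfolding vieta(1-3) by (simp add: algebra_simps)
  qed
  from binet_tribonacci[of U, OF this]
  have binet: "\<phi> * U m = A * \<alpha> ^ m - B * \<omega>1 ^ m + C * \<omega>2 ^ m" for m
    by (simp add: \<phi> A_def B_def C_def P Q R U_def)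
  have square: "\<phi>^2 * U m ^ 2 = A^2 * \<alpha> ^ (2 * m) + B^2 * \<omega>1 ^ (2 * m) + C^2 * \<omega>2 ^ (2 * m)
      - 2 * (A * B * (\<alpha> * \<omega>1) ^ m - A * C * (\<alpha> * \<omega>2) ^ m + B * C * (\<omega>1 * \<omega>2) ^ m)" for m
  proof -
    have expand: "(A * x - B * y + C * z)^2 = A^2 * x^2 + B^2 * y^2 + C^2 * z^2
        - 2 * (A * B * (x * y) - A * C * (x * z) + B * C * (y * z))" for x y z
      by algebra
    have "\<phi>^2 * U m ^ 2 = (A * \<alpha> ^ m - B * \<omega>1 ^ m + C * \<omega>2 ^ m)^2"
      by (simp flip: binet add: power_mult_distrib)
    then show ?thesis
      by (simp only: power_even_eq power_mult_distrib[of _ _ m] expand)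
  qed
  have over: "(\<Sum>l\<le>7. x ^ (2 * (n + l))) = over_sum x * x ^ (2 * n)" for x
    unfolding over_sum_def sum_distrib_right distrib_left power_add by (simp only: mult.commute)
  have under: "(\<Sum>l\<le>7. x ^ (n + l)) = under_sum x * x ^ n" for x
    unfolding under_sum_def sum_distrib_right power_add by (simp only: mult.commute)
  have "\<phi>^2 * of_real ((Nr (tribonacci_octonion V n))\<^sup>2) = (\<Sum>l\<le>7. \<phi>^2 * U (n + l) ^ 2)"
    by (simp only: Nr_tribonacci_octonion U_def of_real_sum of_real_power sum_distrib_left)
  also have "\<dots> = A^2 * (over_sum \<alpha> * \<alpha> ^ (2 * n)) + B^2 * (over_sum \<omega>1 * \<omega>1 ^ (2 * n))
      + C^2 * (over_sum \<omega>2 * \<omega>2 ^ (2 * n))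
      - 2 * (A * B * (under_sum (\<alpha> * \<omega>1) * (\<alpha> * \<omega>1) ^ n)
        - A * C * (under_sum (\<alpha> * \<omega>2) * (\<alpha> * \<omega>2) ^ n)
        + B * C * (under_sum (\<omega>1 * \<omega>2) * (\<omega>1 * \<omega>2) ^ n))"
    unfolding square over[symmetric] under[symmetric]
    by (simp only: sum.distrib sum_subtractf sum_distrib_left[symmetric])
  also have "\<dots> = (\<omega>1 - \<omega>2)^2 * P^2 * over_sum \<alpha> * \<alpha> ^ (2 * n)
       + (\<alpha> - \<omega>2)^2 * Q^2 * over_sum \<omega>1 * \<omega>1 ^ (2 * n)
       + (\<alpha> - \<omega>1)^2 * R^2 * over_sum \<omega>2 * \<omega>2 ^ (2 * n)
       - 2 * K"
    by (simp only: A_def B_def C_def K power_mult_distrib mult.assoc mult.left_commute)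
  finally show ?thesis
    using nz by (simp add: field_simps)
qed

end
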